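(* If $\mathcal{A}$ is an $n$-state deterministic automaton without unobservable events, then the (worst-case) time complexity of Algorithm 2 (observer-based IFO verification) is bounded from above by $O(n^2(n+1)^n)$ and from below by $(n+1)^n$.
   Context: An automaton is a triple $\mathcal{A}=(Q,\Sigma,\delta)$ with a finite state set $Q$, a finite nonempty alphabet $\Sigma$ (events), and $\delta\colon Q\times\Sigma\to 2^Q$, extended to $2^Q\times\Sigma^*$ as usual. It is deterministic if $|\delta(q,a)|\le 1$ for all $q\in Q$, $a\in\Sigma$. $\mathcal{A}[I,F]$ denotes the NFA that is a copy of $\mathcal{A}$ with initial states $I$ and final states $F$ (a singleton is written as its element). $\Sigma_o\subseteq\Sigma$ is the set of observable events and $P\colon\Sigma^*\to\Sigma_o^*$ is the morphism erasing the unobservable events; without unobservable events, $\Sigma_o=\Sigma$ and $P$ is the identity. IFO: $\mathcal{A}$ is initial-and-final-state opaque (IFO) with respect to sets of secret and nonsecret pairs of states $Q_S,Q_{NS}\subseteq Q\times Q$ and $P$ if for all $(s,t)\in Q_S$ and all $w$ with $t\in\delta(s,w)$ there are $(s',t')\in Q_{NS}$ and $w'$ with $t'\in\delta(s',w')$ and $P(w)=P(w')$. A set $S\subseteq Q\times Q$ of pairs is represented in clustered form as a set of pairs $(s,T)\in Q\times 2^Q$, where $f\in T$ if and only if $(s,f)\in S$. The disjoint union of automata makes their state sets pairwise disjoint by renaming and takes the component-wise union. The observer of an NFA is the reachable part of the DFA obtained by the standard subset construction from its projected automaton (the automaton over $\Sigma_o$ with the same states obtained by replacing each transition $(q,a,r)$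 by $(q,P(a),r)$ and eliminating $\varepsilon$-transitions). Algorithm 2 (input: $\mathcal{A}$, clustered $Q_S,Q_{NS}\subseteq Q\times 2^Q$, $\Sigma_o$; output: true iff $\mathcal{A}$ is IFO): let $\mathcal{A}_S$ be the disjoint union of $\mathcal{A}[s,T]$ for $(s,T)\in Q_S$; let $\mathcal{A}_{NS}$ be the disjoint union of $\mathcal{A}[s,T]$ for $(s,T)\in Q_{NS}$; compute the observer $\mathcal{A}_{NS}^{obs}$ of $\mathcal{A}_{NS}$; return whether the product of $\mathcal{A}_S$ with the complement of $\mathcal{A}_{NS}^{obs}$ accepts the empty language (that is, with all events observable, whether $L_m(\mathcal{A}_S)\subseteq L_m(\mathcal{A}_{NS})$, where $L_m$ denotes the accepted language). *)

theory Defs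
  imports
    "HOL-Library.While_Combinator"
    "HOL-Library.Extended_Nat"
    "HOL-Library.Landau_Symbols"
begin

section \<open>Automata\<close>

record ('q, 'a) automaton =
  states :: "'q set"
  events :: "'a set"
  trans :: "'q \<Rightarrow> 'a \<Rightarrow> 'q set"

record ('q, 'a) nfa = "('q, 'a) automaton" +
  init :: "'q set"
  final :: "'q set"

definition automaton :: "('q, 'a, 'z) automaton_scheme \<Rightarrow> bool" where
  "automaton A \<longleftrightarrow> finite (states A) \<and> finite (events A) \<and> events A \<noteq> {} \<and>
     (\<forall>q\<in>states A. \<forall>a\<in>events A. trans A q a \<subseteq> states A)"

definition deterministic :: "('q, 'a, 'z) automaton_scheme \<Rightarrow> bool" where
  "deterministic A \<longleftrightarrow> (\<forall>q\<in>states A. \<forall>a\<in>events A. card (trans A q a) \<le> 1)"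

definition image_trans :: "('q, 'a, 'z) automaton_scheme \<Rightarrow> 'q set \<Rightarrow> 'a \<Rightarrow> 'q set" where
  "image_trans A X a = (\<Union>q\<in>X. trans A q a)"

definition trans_star :: "('q, 'a, 'z) automaton_scheme \<Rightarrow> 'q set \<Rightarrow> 'a list \<Rightarrow> 'q set" where
  "trans_star A X w = foldl (image_trans A) X w"

definition proj :: "'a set \<Rightarrow> 'a list \<Rightarrow> 'a list" where
  "proj \<Sigma>\<^sub>o w = filter (\<lambda>a. a \<in> \<Sigma>\<^sub>o) w"

definition with_init_final :: "('q, 'a) automaton \<Rightarrow> 'q set \<Rightarrow> 'q set \<Rightarrow> ('q, 'a) nfa" where
  "with_init_final A I F =
     \<lparr>states = states A, events = events A, trans = trans A, init = I, final = F\<rparr>"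

definition IFO :: "('q, 'a) automaton \<Rightarrow> ('q \<times> 'q) set \<Rightarrow> ('q \<times> 'q) set \<Rightarrow> 'a set \<Rightarrow> bool" where
  "IFO A Q\<^sub>S Q\<^sub>N \<Sigma>\<^sub>o \<longleftrightarrow>
     (\<forall>(s, t)\<in>Q\<^sub>S. \<forall>w\<in>lists (events A). t \<in> trans_star A {s} w \<longrightarrow>
        (\<exists>(s', t')\<in>Q\<^sub>N. \<exists>w'\<in>lists (events A).
            t' \<in> trans_star A {s'} w' \<and> proj \<Sigma>\<^sub>o w = proj \<Sigma>\<^sub>o w'))"

text \<open>Every state occurs in at most one cluster. Clusters \<open>(s, {})\<close> are optional.\<close>

definition clustered_form ::
    "'q set \<Rightarrow> ('q \<times> 'q) set \<Rightarrow> ('q \<times> 'q set) set \<Rightarrow> bool" where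
  "clustered_form Q S C \<longleftrightarrow> C \<subseteq> Q \<times> Pow Q \<and> fst ` S \<subseteq> fst ` C \<and>
     (\<forall>(s, T)\<in>C. \<forall>f. f \<in> T \<longleftrightarrow> (s, f) \<in> S)"


section \<open>Constructions\<close>

text \<open>The components share one alphabet, which is passed explicitly so that it is also the
  alphabet of the empty union.\<close>

definition disjoint_union :: "'a set \<Rightarrow> 'i set \<Rightarrow> ('i \<Rightarrow> ('q, 'a) nfa) \<Rightarrow> ('i \<times> 'q, 'a) nfa" where
  "disjoint_union \<Sigma> I M =
     \<lparr>states = (SIGMA i:I. states (M i)), events = \<Sigma>,
      trans = (\<lambda>(i, q) a. {i} \<times> trans (M i) q a),
      init = (SIGMA i:I. init (M i)), final = (SIGMA i:I. final (M i))\<rparr>"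

definition cluster_union ::
    "('q, 'a) automaton \<Rightarrow> ('q \<times> 'q set) set \<Rightarrow> (('q \<times> 'q set) \<times> 'q, 'a) nfa" where
  "cluster_union A C = disjoint_union (events A) C (\<lambda>(s, T). with_init_final A {s} T)"

definition eclose :: "'a set \<Rightarrow> ('q, 'a) nfa \<Rightarrow> 'q \<Rightarrow> 'q set" where
  "eclose \<Sigma>\<^sub>o N q = (\<Union>u\<in>lists (events N - \<Sigma>\<^sub>o). trans_star N {q} u)"

definition projected :: "'a set \<Rightarrow> ('q, 'a) nfa \<Rightarrow> ('q, 'a) nfa" where
  "projected \<Sigma>\<^sub>o N =
     \<lparr>states = states N, events = \<Sigma>\<^sub>o,
      trans = (\<lambda>q a. \<Union>p\<in>eclose \<Sigma>\<^sub>o N q. \<Union>r\<in>trans N p a. eclose \<Sigma>\<^sub>o N r),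
      init = (\<Union>q\<in>init N. eclose \<Sigma>\<^sub>o N q), final = final N\<rparr>"

text \<open>The empty set is an ordinary state of the subset construction, so the result is total.\<close>

definition subset_construction :: "('q, 'a) nfa \<Rightarrow> ('q set, 'a) nfa" where
  "subset_construction N =
     \<lparr>states = Pow (states N), events = events N,
      trans = (\<lambda>X a. {image_trans N X a}),
      init = {init N}, final = {X \<in> Pow (states N). X \<inter> final N \<noteq> {}}\<rparr>"

definition restrict_states :: "('q, 'a) nfa \<Rightarrow> 'q set \<Rightarrow> ('q, 'a) nfa" where
  "restrict_states M V =
     M\<lparr>states := states M \<inter> V, trans := (\<lambda>q a. trans M q a \<inter> V),
       init := init M \<inter> V, final := final M \<inter> V\<rparr>"

text \<open>Only meaningful for total deterministic automata.\<close>

definition complement :: "('q, 'a) nfa \<Rightarrow> ('q, 'a) nfa" where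
  "complement M = M\<lparr>final := states M - final M\<rparr>"

text \<open>The second automaton does not move under events outside its alphabet, i.e. under
  unobservable ones. If all events are observable this is the usual intersection product.\<close>

definition product :: "('p, 'a) nfa \<Rightarrow> ('q, 'a) nfa \<Rightarrow> ('p \<times> 'q, 'a) nfa" where
  "product M N =
     \<lparr>states = states M \<times> states N, events = events M,
      trans = (\<lambda>(p, q) a. trans M p a \<times> (if a \<in> events N then trans N q a else {q})),
      init = init M \<times> init N, final = final M \<times> final N\<rparr>"


section \<open>The observer-based algorithm and its running time\<close>

text \<open>
  Time is the number of elementary operations of a random access machine on which states and
  events are machine words, \<open>trans A q a\<close> is a linked list found by one table access, and a
  set \<open>X\<close> is looked up in (or inserted into) a dictionary of sets in time \<open>1 + card X\<close>, e.g.
  with a trie. The states of the observer are numbered when they are found; in the product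
  they are handled through these numbers, in constant time.
\<close>

definition nfa_size :: "('q, 'a) nfa \<Rightarrow> nat" where
  "nfa_size N = card (states N) + card (events N)
     + (\<Sum>q\<in>states N. \<Sum>a\<in>events N. 1 + card (trans N q a))
     + card (init N) + card (final N)"

text \<open>First a search along unobservable transitions from every state, then the tabulation of
  the new transitions and initial states.\<close>

definition projection_time :: "'a set \<Rightarrow> ('q, 'a) nfa \<Rightarrow> nat" where
  "projection_time \<Sigma>\<^sub>o N =
     (\<Sum>q\<in>states N. \<Sum>p\<in>eclose \<Sigma>\<^sub>o N q. 1 + (\<Sum>a\<in>events N - \<Sigma>\<^sub>o. 1 + card (trans N p a)))
   + (\<Sum>q\<in>states N. \<Sum>a\<in>\<Sigma>\<^sub>o. 1 + (\<Sum>p\<in>eclose \<Sigma>\<^sub>o N q. 1 +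
        (\<Sum>r\<in>trans N p a. 1 + card (eclose \<Sigma>\<^sub>o N r))))
   + (\<Sum>q\<in>init N. 1 + card (eclose \<Sigma>\<^sub>o N q))"

text \<open>Processing one state of the observer: decide whether it is final; for every event
  collect the successors of its elements and look up the resulting set.\<close>

definition subset_time :: "('q, 'a) nfa \<Rightarrow> 'q set \<Rightarrow> nat" where
  "subset_time N X = 1 + card X
     + (\<Sum>a\<in>events N. 1 + (\<Sum>q\<in>X. 1 + card (trans N q a)) + (1 + card (image_trans N X a)))"

text \<open>Processing one state of an explicitly given automaton: test whether it is final and
  follow its outgoing transitions.\<close>

definition state_time :: "('q, 'a) nfa \<Rightarrow> 'q \<Rightarrow> nat" where
  "state_time M q = 1 + (\<Sum>a\<in>events M. 1 + card (trans M q a))"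

text \<open>Worklist search from the initial states. The loop state consists of the discovered
  states, those not yet processed, and the time spent; \<open>None\<close> means divergence.\<close>

definition explore :: "('q, 'a) nfa \<Rightarrow> ('q \<Rightarrow> nat) \<Rightarrow> ('q set \<times> nat) option" where
  "explore M cost = map_option (\<lambda>(V, W, t). (V, t))
     (while_option (\<lambda>(V, W, t). W \<noteq> {})
        (\<lambda>(V, W, t).
           let q = (SOME q. q \<in> W);
               N = (\<Union>a\<in>events M. trans M q a) - V
           in (V \<union> N, W - {q} \<union> N, t + cost q))
        (init M, init M, 0))"

text \<open>The result and the running time; \<open>None\<close> means divergence.\<close>

definition ifo_algorithm ::
    "('q, 'a) automaton \<Rightarrow> ('q \<times> 'q set) set \<Rightarrow> ('q \<times> 'q set) set \<Rightarrow> 'a set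
     \<Rightarrow> (bool \<times> nat) option" where
  "ifo_algorithm A C\<^sub>S C\<^sub>N \<Sigma>\<^sub>o =
     (let A\<^sub>S = cluster_union A C\<^sub>S;
          A\<^sub>N = cluster_union A C\<^sub>N;
          P\<^sub>N = projected \<Sigma>\<^sub>o A\<^sub>N;
          D = subset_construction P\<^sub>N
      in case explore D (subset_time P\<^sub>N) of
           None \<Rightarrow> None
         | Some (V, t1) \<Rightarrow>
             (let Obs = restrict_states D V;
                  B = product A\<^sub>S (complement Obs)
              in case explore B (state_time B) of
                   None \<Rightarrow> None
                 | Some (R, t2) \<Rightarrow>
                     Some (R \<inter> final B = {},
                       nfa_size A\<^sub>S + nfa_size A\<^sub>N + projection_time \<Sigma>\<^sub>o A\<^sub>N
                       + (1 + card (init P\<^sub>N)) + t1 + card V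
                       + (1 + card (init B)) + t2)))"

definition ifo_time ::
    "('q, 'a) automaton \<Rightarrow> ('q \<times> 'q set) set \<Rightarrow> ('q \<times> 'q set) set \<Rightarrow> 'a set \<Rightarrow> enat" where
  "ifo_time A C\<^sub>S C\<^sub>N \<Sigma>\<^sub>o =
     (case ifo_algorithm A C\<^sub>S C\<^sub>N \<Sigma>\<^sub>o of None \<Rightarrow> \<infinity> | Some (b, t) \<Rightarrow> enat t)"

text \<open>Worst case over the deterministic automata with \<open>n\<close> states and \<open>k\<close> events, all of them
  observable. Taking states and events to be natural numbers loses no generality.\<close>

definition worst_case_time_det_obs :: "nat \<Rightarrow> nat \<Rightarrow> enat" where
  "worst_case_time_det_obs k n =
     Sup {ifo_time A C\<^sub>S C\<^sub>N \<Sigma>\<^sub>o | (A :: (nat, nat) automaton) Q\<^sub>S Q\<^sub>N C\<^sub>S C\<^sub>N \<Sigma>\<^sub>o.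
       automaton A \<and> deterministic A \<and> card (states A) = n \<and> card (events A) = k \<and>
       \<Sigma>\<^sub>o = events A \<and>
       Q\<^sub>S \<subseteq> states A \<times> states A \<and> Q\<^sub>N \<subseteq> states A \<times> states A \<and>
       clustered_form (states A) Q\<^sub>S C\<^sub>S \<and> clustered_form (states A) Q\<^sub>N C\<^sub>N}"

section \<open>The algorithm decides initial-and-final-state opacity\<close>

definition reach :: "('q, 'a) nfa \<Rightarrow> 'q set" where
  "reach M = (\<Union>w\<in>lists (events M). trans_star M (init M) w)"

lemma ts_Nil[simp]: "trans_star A X [] = X" by (simp add: trans_star_def)
lemma ts_Cons: "trans_star A X (a#w) = trans_star A (image_trans A X a) w" by (simp add: trans_star_def)
lemma ts_snoc: "trans_star A X (w@[a]) = image_trans A (trans_star A X w) a" by (simp add: trans_star_def)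
lemma ts_app: "trans_star A X (w@v) = trans_star A (trans_star A X w) v" by (simp add: trans_star_def)
lemma ts_UN: "trans_star A (\<Union>i\<in>I. f i) w = (\<Union>i\<in>I. trans_star A (f i) w)"
  by (induction w arbitrary: f) (simp_all add: ts_Cons image_trans_def UN_UN_flatten)
lemma ts_pt: "trans_star A X w = (\<Union>q\<in>X. trans_star A {q} w)"
  using ts_UN[of A "\<lambda>q. {q}" X w] by simp

lemma explore_eq:
  assumes fin: "finite S" and i: "init M \<subseteq> S"
    and cl: "\<And>q a. q \<in> S \<Longrightarrow> a \<in> events M \<Longrightarrow> trans M q a \<subseteq> S"
  shows "explore M cost = Some (reach M, \<Sum>q\<in>reach M. cost q)"
proof -
  let ?N = "\<lambda>q V. (\<Union>a\<in>events M. trans M q a) - V"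
  let ?b = "\<lambda>(V, W, t::nat). W \<noteq> {}"
  let ?c = "\<lambda>(V, W, t). let q = (SOME q. q \<in> W); N = (\<Union>a\<in>events M. trans M q a) - V
           in (V \<union> N, W - {q} \<union> N, t + cost q)"
  have rS: "reach M \<subseteq> S"
  proof -
    have "trans_star M (init M) w \<subseteq> S" if "w \<in> lists (events M)" for w
      using that i
    proof (induction w rule: rev_induct)
      case (snoc a w) then show ?case using cl by (auto simp: ts_snoc image_trans_def) (blast)
    qed simp
    then show ?thesis by (auto simp: reach_def)
  qed
  have rstep: "trans M q a \<subseteq> reach M" if "q \<in> reach M" "a \<in> events M" for q a
  proof -
    from that obtain w where w: "w \<in> lists (events M)" "q \<in> trans_star M (init M) w" by (auto simp: reach_def)
    then have "w@[a] \<in> lists (events M)" using that by simp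
    moreover have "trans M q a \<subseteq> trans_star M (init M) (w@[a])" using w by (auto simp: ts_snoc image_trans_def)
    ultimately show ?thesis unfolding reach_def by blast
  qed
  define P where "P = (\<lambda>(V, W, t). init M \<subseteq> V \<and> W \<subseteq> V \<and> V \<subseteq> reach M
     \<and> (\<forall>q\<in>V-W. \<forall>a\<in>events M. trans M q a \<subseteq> V) \<and> t = (\<Sum>q\<in>V-W. cost q))"
  have P0: "P (init M, init M, 0)"
  proof -
    have "init M \<subseteq> reach M" using UN_upper[OF lists.Nil, of "trans_star M (init M)" "events M"] by (simp add: reach_def)
    then show ?thesis by (simp add: P_def)
  qed
  have step: "P (?c s) \<and> card (S - (fst (?c s) - fst (snd (?c s)))) < card (S - (fst s - fst (snd s)))"
    if "P s" "?b s" for s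
  proof -
    obtain V W t where s: "s = (V,W,t)" by (cases s) auto
    define q where "q = (SOME q. q \<in> W)"
    have qW: "q \<in> W" using that(2) unfolding s q_def by (auto intro: someI)
    let ?V = "V \<union> ?N q V" and ?W = "W - {q} \<union> ?N q V"
    have c: "?c s = (?V, ?W, t + cost q)" by (simp add: s q_def Let_def)
    have I: "init M \<subseteq> V" "W \<subseteq> V" "V \<subseteq> reach M" "\<forall>q\<in>V-W. \<forall>a\<in>events M. trans M q a \<subseteq> V" "t = (\<Sum>q\<in>V-W. cost q)"
      using that(1) by (auto simp: P_def s)
    have d: "?V - ?W = insert q (V - W)" using I qW by auto
    have fV: "finite (V - W)" using I(3) rS fin by (meson finite_Diff finite_subset)
    have qr: "q \<in> reach M" using qW I by auto
    have a1: "?N q V \<subseteq> reach M" using rstep[OF qr] by blast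
    have a2: "\<forall>p\<in>insert q (V-W). \<forall>a\<in>events M. trans M p a \<subseteq> ?V" using I(4) by blast
    have a3: "t + cost q = sum cost (insert q (V-W))" using I(5) fV qW by simp
    have a4: "init M \<subseteq> ?V" "?W \<subseteq> ?V" "?V \<subseteq> reach M" using I(1-3) a1 by auto
    have "P (?c s)" unfolding c P_def prod.case d using a2 a3 a4 by (intro conjI)
    moreover have "card (S - insert q (V - W)) < card (S - (V - W))"
    proof (rule psubset_card_mono)
      have "q \<in> S - (V - W)" using qW qr rS by auto
      then show "S - insert q (V - W) \<subset> S - (V - W)" by blast
    qed (use fin in simp)
    ultimately show ?thesis unfolding c fst_conv snd_conv d by (simp add: s)
  qed
  obtain s where s: "while_option ?b ?c (init M, init M, 0) = Some s"
    using measure_while_option_Some[of P ?b ?c "\<lambda>s. card (S - (fst s - fst (snd s)))", OF step P0] by blast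
  have Ps: "P s" by (rule while_option_rule[of P ?b ?c, OF step[THEN conjunct1] s P0])
  have nb: "\<not> ?b s" using while_option_stop[OF s] .
  obtain V t where sv: "s = (V,{},t)" using nb by (cases s) auto
  have I: "init M \<subseteq> V" "V \<subseteq> reach M" "\<forall>q\<in>V. \<forall>a\<in>events M. trans M q a \<subseteq> V" "t = (\<Sum>q\<in>V. cost q)"
    using Ps by (auto simp: P_def sv)
  have "trans_star M (init M) w \<subseteq> V" if "w \<in> lists (events M)" for w
    using that I(1)
  proof (induction w rule: rev_induct)
    case (snoc a w)
    then have "trans_star M (init M) w \<subseteq> V" "a \<in> events M" by auto
    then show ?case using I(3) unfolding ts_snoc image_trans_def by blast
  qed simp
  then have "V = reach M" using I by (auto simp: reach_def)
  then show ?thesis using s I by (simp add: explore_def sv)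
qed

lemma eclose_refl: "q \<in> eclose So N q"
  unfolding eclose_def by (rule UN_I[OF lists.Nil]) simp

lemma filter_single:
  "filter P w = v @ [a] \<Longrightarrow> \<exists>x y. w = x @ a # y \<and> filter P x = v \<and> filter P y = [] \<and> P a"
proof (induction w rule: rev_induct)
  case (snoc b w)
  show ?case
  proof (cases "P b")
    case True then show ?thesis using snoc.prems by (intro exI[of _ w] exI[of _ "[]"]) auto
  next
    case False
    then have "filter P w = v @ [a]" using snoc.prems by simp
    from snoc.IH[OF this] obtain x y where "w = x @ a # y \<and> filter P x = v \<and> filter P y = [] \<and> P a" by blast
    then show ?thesis using False by (intro exI[of _ x] exI[of _ "y@[b]"]) auto
  qed
qed simp

lemma lists_proj: "w \<in> lists E \<Longrightarrow> proj So w = [] \<longleftrightarrow> w \<in> lists (E - So)"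
  by (induction w) (auto simp: proj_def)

definition obs :: "'a set \<Rightarrow> ('q,'a) nfa \<Rightarrow> 'a list \<Rightarrow> 'q set" where
  "obs So N v = (\<Union>w\<in>{w\<in>lists (events N). proj So w = v}. trans_star N (init N) w)"

lemma obs_eclosed: assumes "p \<in> obs So N v" shows "eclose So N p \<subseteq> obs So N v"
proof
  fix r assume "r \<in> eclose So N p"
  then obtain u where u: "u \<in> lists (events N - So)" "r \<in> trans_star N {p} u" by (auto simp: eclose_def)
  obtain w where w: "w \<in> lists (events N)" "proj So w = v" "p \<in> trans_star N (init N) w" using assms by (auto simp: obs_def)
  have "r \<in> trans_star N (init N) (w@u)" using u w by (subst ts_app, subst ts_pt) auto
  moreover have "proj So u = []" "u \<in> lists (events N)" using u lists_proj[of u "events N" So] by auto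
  ultimately show "r \<in> obs So N v" using w unfolding obs_def by (intro UN_I[of "w@u"]) (auto simp: proj_def)
qed

lemma trans_star_projected:
  assumes "So \<subseteq> events N" "v \<in> lists So"
  shows "trans_star (projected So N) (init (projected So N)) v = obs So N v"
  using assms(2)
proof (induction v rule: rev_induct)
  case Nil
  have "init (projected So N) = (\<Union>w\<in>lists (events N - So). trans_star N (init N) w)"
    using ts_pt[of N "init N"] unfolding projected_def eclose_def nfa.simps automaton.simps by blast
  also have "\<dots> = obs So N []" unfolding obs_def using lists_proj[of _ "events N" So] by (auto simp: in_lists_conv_set)
  finally show ?case by simp
next
  case (snoc a v)
  have a: "a \<in> So" "v \<in> lists So" using snoc by auto
  have "trans_star (projected So N) (init (projected So N)) (v@[a]) = 
     (\<Union>q\<in>obs So N v. \<Union>p\<in>eclose So N q. \<Union>r\<in>trans N p a. eclose So N r)"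
    using snoc.IH[OF a(2)] by (simp add: ts_snoc image_trans_def) (simp add: projected_def)
  also have "\<dots> = (\<Union>p\<in>obs So N v. \<Union>r\<in>trans N p a. eclose So N r)"
    using obs_eclosed[of _ So N v] eclose_refl[of _ So N] by blast
  also have "\<dots> = obs So N (v@[a])"
  proof (intro equalityI subsetI)
    fix s assume "s \<in> (\<Union>p\<in>obs So N v. \<Union>r\<in>trans N p a. eclose So N r)"
    then obtain p r where pr: "p \<in> obs So N v" "r \<in> trans N p a" "s \<in> eclose So N r" by auto
    then obtain w where w: "w \<in> lists (events N)" "proj So w = v" "p \<in> trans_star N (init N) w" by (auto simp: obs_def)
    have "r \<in> trans_star N (init N) (w@[a])" using w pr by (auto simp: ts_snoc image_trans_def)
    then have "r \<in> obs So N (v@[a])" unfolding obs_def using w a assms(1)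
      by (intro UN_I[of "w@[a]"]) (auto simp: proj_def)
    then show "s \<in> obs So N (v@[a])" using subsetD[OF obs_eclosed pr(3)] by simp
  next
    fix s assume "s \<in> obs So N (v@[a])"
    then obtain w where w: "w \<in> lists (events N)" "proj So w = v@[a]" "s \<in> trans_star N (init N) w" by (auto simp: obs_def)
    obtain x y where xy: "w = x @ a # y" "proj So x = v" "proj So y = []" using filter_single w(2) unfolding proj_def by metis
    have "s \<in> trans_star N (image_trans N (trans_star N (init N) x) a) y" using w(3) xy by (simp add: ts_app ts_Cons)
    then obtain r where r: "r \<in> image_trans N (trans_star N (init N) x) a" "s \<in> trans_star N {r} y"
      by (subst (asm) ts_pt) auto
    have "y \<in> lists (events N - So)" using lists_proj[of y "events N" So] w(1) xy(1,3) by simp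
    then have se: "s \<in> eclose So N r" using r(2) unfolding eclose_def by (rule UN_I)
    obtain p where p: "p \<in> trans_star N (init N) x" "r \<in> trans N p a" using r by (auto simp: image_trans_def)
    have "p \<in> obs So N v" unfolding obs_def using p xy w by (intro UN_I[of x]) auto
    then show "s \<in> (\<Union>p\<in>obs So N v. \<Union>r\<in>trans N p a. eclose So N r)" using p se by blast
  qed
  finally show ?case .
qed

lemma ts_subset_construction:
  "trans_star (subset_construction N) {X} w = {trans_star N X w}"
  by (induction w arbitrary: X) (simp_all add: ts_Cons image_trans_def subset_construction_def)

lemma ts_cluster:
  "trans_star (cluster_union A C) {(i, q)} w = {i} \<times> trans_star A {q} w"
proof (induction w rule: rev_induct)
  case (snoc a w)
  then show ?case by (cases i) (auto simp: ts_snoc image_trans_def cluster_union_def disjoint_union_def with_init_final_def)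
qed simp

lemma ts_product:
  assumes det: "\<And>x a. x \<in> V \<Longrightarrow> a \<in> events N \<Longrightarrow> trans N x a = {d x a} \<and> d x a \<in> V"
    and x: "x \<in> V"
  shows "trans_star (product M N) (I \<times> {x}) w = trans_star M I w \<times> {foldl d x (proj (events N) w)}
    \<and> foldl d x (proj (events N) w) \<in> V"
proof (induction w rule: rev_induct)
  case Nil then show ?case using x by (simp add: proj_def)
next
  case (snoc a w)
  define y where "y = foldl d x (proj (events N) w)"
  have IH: "trans_star (product M N) (I \<times> {x}) w = trans_star M I w \<times> {y}" "y \<in> V"
    using snoc by (simp_all add: y_def)
  have p: "foldl d x (proj (events N) (w@[a])) = (if a \<in> events N then d y a else y)"
    by (simp add: proj_def y_def)
  have "(\<Union>q\<in>X \<times> {y}. trans (product M N) q a) = 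
      (\<Union>q\<in>X. trans M q a) \<times> (if a \<in> events N then trans N y a else {y})" for X
    by (auto simp: product_def)
  then show ?case unfolding p ts_snoc image_trans_def IH(1) using det[OF IH(2)] IH(2) by simp
qed

lemma trans_star_sub:
  assumes "\<And>q a. q \<in> S \<Longrightarrow> a \<in> E \<Longrightarrow> trans N q a \<subseteq> S" "X \<subseteq> S" "w \<in> lists E"
  shows "trans_star N X w \<subseteq> S"
  using assms(3,2)
proof (induction w arbitrary: X)
  case (Cons a w)
  have "image_trans N X a \<subseteq> S" unfolding image_trans_def
  proof (rule UN_least)
    fix q assume "q \<in> X"
    then show "trans N q a \<subseteq> S" using Cons.prems Cons.hyps assms(1)[of q a] by blast
  qed
  then show ?case using Cons by (simp add: ts_Cons)
qed simp

theorem ifo_algorithm_correct: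
  assumes A: "automaton A" and So: "So \<subseteq> events A"
    and CS: "clustered_form (states A) QS CS" and CN: "clustered_form (states A) QN CN"
  shows "\<exists>t. ifo_algorithm A CS CN So = Some (IFO A QS QN So, t)"
proof -
  define AS where "AS = cluster_union A CS"
  define AN where "AN = cluster_union A CN"
  define PN where "PN = projected So AN"
  define D where "D = subset_construction PN"
  have finC: "finite C" if "clustered_form (states A) Q C" for Q C
    using that A by (auto simp: clustered_form_def automaton_def intro: finite_subset)
  have ev[simp]: "events AS = events A" "events AN = events A" "events PN = So" "events D = So"
    by (simp_all add: AS_def AN_def PN_def D_def cluster_union_def disjoint_union_def projected_def subset_construction_def)
  have clN: "trans (cluster_union A C) q a \<subseteq> states (cluster_union A C)" if "q \<in> states (cluster_union A C)" "a \<in> events A" for q a C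
    using that A by (fastforce simp: cluster_union_def disjoint_union_def with_init_final_def automaton_def)
  have finst: "finite (states (cluster_union A C))" if "clustered_form (states A) Q C" for Q C
    using finC[OF that] A by (auto simp: cluster_union_def disjoint_union_def with_init_final_def automaton_def intro!: finite_SigmaI)
  have inist: "init (cluster_union A C) \<subseteq> states (cluster_union A C)" if "clustered_form (states A) Q C" for Q C
    using that by (auto simp: cluster_union_def disjoint_union_def with_init_final_def clustered_form_def)
  have ecl: "eclose So AN q \<subseteq> states AN" if "q \<in> states AN" for q
    unfolding eclose_def using trans_star_sub[of "states AN" "events A" AN "{q}"] clN[of _ CN] that 
    by (auto simp: AN_def[symmetric] in_lists_conv_set) blast
  have stP[simp]: "states PN = states AN" by (simp add: PN_def projected_def)
  have inP: "init PN \<subseteq> states AN" using ecl inist[OF CN] by (auto simp: PN_def projected_def AN_def[symmetric])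
  have trP: "trans PN q a \<subseteq> states AN" if "q \<in> states AN" "a \<in> So" for q a
  proof -
    have "trans AN p a \<subseteq> states AN" if "p \<in> states AN" for p using clN[of p CN a] that \<open>a \<in> So\<close> So by (auto simp: AN_def)
    then show ?thesis using ecl that by (simp add: PN_def projected_def) blast
  qed
  have finAN: "finite (states AN)" using finst[OF CN] by (simp add: AN_def)
  have trD: "trans D X a = {image_trans PN X a}" "init D = {init PN}" for X a
    by (simp_all add: D_def subset_construction_def)
  have imP: "image_trans PN X a \<subseteq> states AN" if "X \<subseteq> states AN" "a \<in> So" for X a
    using trP that unfolding image_trans_def by blast
  have eD: "explore D (subset_time PN) = Some (reach D, \<Sum>q\<in>reach D. subset_time PN q)"
    by (rule explore_eq[where S="Pow (states AN)"])
       (use finAN inP imP in \<open>simp_all add: trD\<close>)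
  define Obs where "Obs = restrict_states D (reach D)"
  define B where "B = product AS (complement Obs)"
  have tD: "trans_star D (init D) v = {obs So AN v}" if "v \<in> lists So" for v
    using trans_star_projected[of So AN v] So that
    unfolding trD(2) unfolding D_def by (simp add: ts_subset_construction PN_def)
  have rD: "reach D = (\<lambda>v. obs So AN v) ` lists So"
    unfolding reach_def ev using tD by auto
  have rDs: "reach D \<subseteq> Pow (states AN)"
    unfolding rD obs_def using trans_star_sub[of "states AN" "events A" AN "init AN"] clN[of _ CN] inist[OF CN]
    by (auto simp: AN_def[symmetric])
  let ?d = "\<lambda>X a. image_trans PN X a"
  have dr: "?d X a \<in> reach D" if X: "X \<in> reach D" "a \<in> So" for X a
  proof -
    obtain v where v: "v \<in> lists So" "X = obs So AN v" using X(1) unfolding rD by blast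
    have "?d X a = obs So AN (v@[a])" using v X trans_star_projected[of So AN] So
      by (metis PN_def ev(2) append_in_lists_conv lists.Cons lists.Nil ts_snoc)
    moreover have "v@[a] \<in> lists So" using v X by simp
    ultimately show ?thesis unfolding rD by blast
  qed
  have iD: "init PN \<in> reach D" unfolding rD using trans_star_projected[of So AN "[]"] So PN_def lists.Nil by (metis ev(2) image_eqI ts_Nil)
  have evB: "events B = events A" "events (complement Obs) = So" "events Obs = So"
    by (simp_all add: B_def product_def complement_def Obs_def restrict_states_def)
  have det: "trans (complement Obs) X a = {?d X a} \<and> ?d X a \<in> reach D" if "X \<in> reach D" "a \<in> events (complement Obs)" for X a
    using dr[OF that(1)] that(2) evB by (simp add: complement_def Obs_def restrict_states_def) (simp add: D_def subset_construction_def)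
  have iB: "init B = init AS \<times> {init PN}" using iD
    by (simp add: B_def product_def complement_def Obs_def restrict_states_def) (simp add: D_def subset_construction_def)
  have clAS: "trans AS q a \<subseteq> states AS" if "q \<in> states AS" "a \<in> events A" for q a
    using clN that by (auto simp: AS_def)
  have eB: "explore B (state_time B) = Some (reach B, \<Sum>q\<in>reach B. state_time B q)"
  proof (rule explore_eq[where S="states AS \<times> reach D"])
    show "finite (states AS \<times> reach D)" using finst[OF CS] rDs finAN by (auto simp: AS_def intro: finite_subset)
    show "init B \<subseteq> states AS \<times> reach D" using iB iD inist[OF CS] by (auto simp: AS_def)
    show "trans B q a \<subseteq> states AS \<times> reach D" if "q \<in> states AS \<times> reach D" "a \<in> events B" for q a
      using that clAS det evB by (auto simp: B_def product_def split: if_splits) blast+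
  qed
  have fo: "foldl ?d (init PN) v = obs So AN v" if "v \<in> lists So" for v
    using trans_star_projected[of So AN v] that So by (simp add: PN_def trans_star_def image_trans_def[abs_def])
  have pl: "proj So w \<in> lists So" for w by (auto simp: proj_def)
  have tB: "trans_star B (init B) w = trans_star AS (init AS) w \<times> {obs So AN (proj So w)}" for w
    using ts_product[of "reach D" "complement Obs" ?d "init PN" AS "init AS" w, OF det iD] iB fo[OF pl] evB
    by (simp add: B_def)
  have fB: "final B = final AS \<times> {X \<in> reach D. X \<inter> final AN = {}}"
    using rDs by (auto simp: B_def product_def complement_def Obs_def restrict_states_def)
       (auto simp: D_def subset_construction_def PN_def projected_def)
  have acc: "trans_star (cluster_union A C) (init (cluster_union A C)) w \<inter> final (cluster_union A C) \<noteq> {}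
       \<longleftrightarrow> (\<exists>(s,t)\<in>Q. t \<in> trans_star A {s} w)" if CF: "clustered_form (states A) Q C" for Q C w
  proof -
    have "trans_star (cluster_union A C) (init (cluster_union A C)) w = (\<Union>c\<in>C. {c} \<times> trans_star A {fst c} w)"
      by (subst ts_pt) (auto simp: ts_cluster cluster_union_def disjoint_union_def with_init_final_def
         ts_cluster[unfolded cluster_union_def disjoint_union_def with_init_final_def])
    moreover have "final (cluster_union A C) = (SIGMA c:C. snd c)"
      by (auto simp: cluster_union_def disjoint_union_def with_init_final_def)
    ultimately have 1: "trans_star (cluster_union A C) (init (cluster_union A C)) w \<inter> final (cluster_union A C) \<noteq> {}
       \<longleftrightarrow> (\<exists>s T t. (s,T) \<in> C \<and> t \<in> T \<and> t \<in> trans_star A {s} w)"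
      by (auto simp: set_eq_iff)
    have cf: "t \<in> T \<longleftrightarrow> (s,t) \<in> Q" if "(s,T) \<in> C" for s T t
    proof -
      have "\<forall>(s, T)\<in>C. \<forall>f. f \<in> T \<longleftrightarrow> (s, f) \<in> Q" using CF unfolding clustered_form_def by simp
      from bspec[OF this that] show ?thesis by simp
    qed
    have 2: "(s,t) \<in> Q \<longleftrightarrow> (\<exists>T. (s,T) \<in> C \<and> t \<in> T)" for s t
    proof
      assume st: "(s,t) \<in> Q"
      then have "s \<in> fst ` C" using CF unfolding clustered_form_def by force
      then obtain T where "(s,T) \<in> C" by auto
      then show "\<exists>T. (s,T) \<in> C \<and> t \<in> T" using st cf by blast
    qed (use cf in blast)
    show ?thesis unfolding 1 using 2 by blast
  qed
  have oN: "obs So AN (proj So w) \<inter> final AN \<noteq> {} \<longleftrightarrow>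
     (\<exists>(s',t')\<in>QN. \<exists>w'\<in>lists (events A). t' \<in> trans_star A {s'} w' \<and> proj So w = proj So w')" for w
  proof -
    have "obs So AN (proj So w) \<inter> final AN \<noteq> {} \<longleftrightarrow> (\<exists>w'\<in>lists (events A). proj So w' = proj So w \<and>
       trans_star AN (init AN) w' \<inter> final AN \<noteq> {})" by (auto simp: obs_def)
    then show ?thesis unfolding AN_def acc[OF CN] by (auto simp: eq_commute)
  qed
  have "reach B \<inter> final B = {} \<longleftrightarrow> (\<forall>w\<in>lists (events A). trans_star AS (init AS) w \<inter> final AS \<noteq> {} 
      \<longrightarrow> obs So AN (proj So w) \<inter> final AN \<noteq> {})"
  proof -
    have o: "obs So AN (proj So w) \<in> reach D" for w using pl[of w] unfolding rD by (rule imageI)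
    have z1: "reach B \<inter> final B = {} \<longleftrightarrow> (\<forall>w\<in>lists (events A). trans_star B (init B) w \<inter> final B = {})"
      unfolding reach_def evB by blast
    have z2: "trans_star B (init B) w \<inter> final B = {} \<longleftrightarrow> (trans_star AS (init AS) w \<inter> final AS \<noteq> {} 
      \<longrightarrow> obs So AN (proj So w) \<inter> final AN \<noteq> {})" for w
      unfolding tB fB using o[of w] by auto
    show ?thesis unfolding z1 z2 ..
  qed
  also have "\<dots> \<longleftrightarrow> IFO A QS QN So"
    unfolding oN IFO_def AS_def acc[OF CS] by (simp add: Ball_def Bex_def split: prod.splits) blast
  finally have R: "(reach B \<inter> final B = {}) = IFO A QS QN So" .
  show ?thesis
    unfolding ifo_algorithm_def Let_def AS_def[symmetric] AN_def[symmetric] PN_def[symmetric]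
      D_def[symmetric] eD option.case prod.case Obs_def[symmetric] B_def[symmetric] eB R by blast
qed

end

theory Submission
  imports Defs "HOL-Combinatorics.Permutations"
begin

text \<open>
  Upper bound: in a deterministic automaton every cluster contributes at most one state to a
  state of the observer, and there are at most \<open>n\<close> clusters, so the observer has at most
  \<open>(n + 1) ^ n\<close> states and the product at most \<open>n\<^sup>2\<close> times as many. For a fixed alphabet, the time
  per state is linear in \<open>n\<close> for the observer and constant for the product.

  Lower bound: five partial maps generate, for every \<open>n\<close>, the monoid of all partial maps on \<open>n\<close>
  points: a cycle, its inverse, a transposition, a map merging two points, and one undefined at a
  single point. Let these act as the events, and take one cluster for every state. Then the state
  the observer reaches on a word is the graph of the partial map which the word induces, so the
  observer has \<open>(n + 1) ^ n\<close> states. The clusters may even be empty, that is, \<open>(s, {})\<close>.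
\<close>

section \<open>Generators of the monoid of partial maps\<close>

text \<open>Generators are added on the outside, which corresponds to appending a letter at the end
  of a word that is read from left to right.\<close>

inductive_set generated :: "('a \<Rightarrow> 'a) set \<Rightarrow> ('a \<Rightarrow> 'a) set" for G where
  id: "id \<in> generated G"
| step: "f \<in> generated G \<Longrightarrow> g \<in> G \<Longrightarrow> g \<circ> f \<in> generated G"

lemma generated_comp:
  assumes "g \<in> generated G" "f \<in> generated G"
  shows "g \<circ> f \<in> generated G"
  using assms(1)
proof induction
  case id
  then show ?case using assms(2) by simp
next
  case (step h g)
  then show ?case using generated.step[of "h \<circ> f" G g] by (metis comp_assoc)
qed

lemma generated_base: "g \<in> G \<Longrightarrow> g \<in> generated G"
  using generated.step[OF generated.id, of g G] by simp

text \<open>Conjugation relabels the two swapped points. With \<open>c\<close> the cycle it shifts a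
  transposition by one place.\<close>

lemma conj_transpose:
  assumes "bij c"
  shows "c \<circ> Transposition.transpose a b \<circ> inv c = Transposition.transpose (c a) (c b)"
proof
  fix x
  obtain y where "x = c y" using assms by (metis bij_pointE)
  then show "(c \<circ> Transposition.transpose a b \<circ> inv c) x = Transposition.transpose (c a) (c b) x"
    using assms by (simp add: Transposition.transpose_def bij_is_inj inj_eq)
qed

definition cyc :: "nat \<Rightarrow> nat \<Rightarrow> nat" where
  "cyc n i = (if n \<le> i then i else if Suc i = n then 0 else Suc i)"

lemma cyc_permutes: "cyc n permutes {..<n}"
proof (rule inj_imp_permutes)
  show "inj_on (cyc n) {..<n}" by (rule inj_onI) (simp add: cyc_def split: if_splits)
qed (auto simp: cyc_def)

text \<open>Partial maps on \<open>{..<n}\<close>, with \<open>n\<close> standing for ``undefined''.\<close>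

definition partial_maps :: "nat \<Rightarrow> (nat \<Rightarrow> nat) set" where
  "partial_maps n = {f. f ` {..<n} \<subseteq> {..n} \<and> (\<forall>x\<ge>n. f x = x)}"

text \<open>Truncated subtraction makes the third and fourth generator the identity for \<open>n \<le> 1\<close>.\<close>

definition generator :: "nat \<Rightarrow> nat \<Rightarrow> nat \<Rightarrow> nat" where
  "generator n a =
     (if a = 0 then cyc n
      else if a = 1 then inv (cyc n)
      else if a = 2 then Transposition.transpose 0 (n - 1)
      else if a = 3 then id(0 := n - 1)
      else if a = 4 then id(0 := n)
      else id)"

lemma generator_partial_maps: "generator n a \<in> partial_maps n"
proof -
  have "p \<in> partial_maps n" if "p permutes {..<n}" for p
    using permutes_image[OF that] permutes_not_in[OF that] by (auto simp: partial_maps_def)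
  from this[OF cyc_permutes] this[OF permutes_inv[OF cyc_permutes]]
  show ?thesis
    by (auto simp: generator_def partial_maps_def Transposition.transpose_def)
qed

abbreviation generators :: "nat \<Rightarrow> (nat \<Rightarrow> nat) set" where
  "generators n \<equiv> generator n ` {..<5}"

section \<open>From the five generators to all partial maps\<close>

lemma generator_generated:
  "cyc n \<in> generated (generators n)"
  "inv (cyc n) \<in> generated (generators n)"
  "Transposition.transpose 0 (n - 1) \<in> generated (generators n)"
  "id(0 := n - 1) \<in> generated (generators n)"
  "id(0 := n) \<in> generated (generators n)"
proof -
  have "generator n a \<in> generated (generators n)" if "a < 5" for a
    using that by (intro generated_base) auto
  from this[of 0] this[of 1] this[of 2] this[of 3] this[of 4] show
    "cyc n \<in> generated (generators n)"
    "inv (cyc n) \<in> generated (generators n)"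
    "Transposition.transpose 0 (n - 1) \<in> generated (generators n)"
    "id(0 := n - 1) \<in> generated (generators n)"
    "id(0 := n) \<in> generated (generators n)"
    by (simp_all add: generator_def)
qed

text \<open>Conjugating repeatedly by the cycle moves the given transposition around. The inverse of
  the cycle is itself a generator, so conjugation does not leave the generated set.\<close>

lemma adjacent_transpose_generated:
  "Suc i < n \<Longrightarrow> Transposition.transpose i (Suc i) \<in> generated (generators n)"
proof (induction i)
  case 0
  have "cyc n \<circ> Transposition.transpose 0 (n - 1) \<circ> inv (cyc n) \<in> generated (generators n)"
    by (intro generated_comp generator_generated)
  \<comment> \<open>The cycle wraps \<open>n - 1\<close> around to \<open>0\<close>, so one shift
    turns the generator into the first adjacent transposition.\<close>
  moreover have "cyc n 0 = Suc 0" "cyc n (n - 1) = 0" using 0 by (auto simp: cyc_def)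
  ultimately show ?case
    by (simp add: conj_transpose[OF permutes_bij[OF cyc_permutes]] transpose_commute)
next
  case (Suc i)
  then have "cyc n \<circ> Transposition.transpose i (Suc i) \<circ> inv (cyc n) \<in> generated (generators n)"
    by (intro generated_comp generator_generated) simp
  then show ?case
    using Suc.prems by (simp add: conj_transpose[OF permutes_bij[OF cyc_permutes]] cyc_def)
qed

text \<open>Conjugating by an adjacent transposition moves the upper point \<open>b\<close> one step
  up while \<open>a\<close> stays fixed.\<close>

lemma less_transpose_generated:
  "a < b \<Longrightarrow> b < n \<Longrightarrow> Transposition.transpose a b \<in> generated (generators n)"
proof (induction b)
  case (Suc b)
  show ?case
  proof (cases "a = b")
    case True
    then show ?thesis using Suc.prems adjacent_transpose_generated by blast
  next
    case False
    let ?s = "Transposition.transpose b (Suc b)"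
    have "?s \<circ> Transposition.transpose a b \<circ> ?s \<in> generated (generators n)"
      using False Suc by (intro generated_comp adjacent_transpose_generated) auto
    moreover have "?s \<circ> Transposition.transpose a b \<circ> ?s = Transposition.transpose a (Suc b)"
      using False Suc.prems by (auto simp: Transposition.transpose_def fun_eq_iff)
    ultimately show ?thesis by simp
  qed
qed simp

lemma permutes_generated:
  assumes "p permutes {..<n}"
  shows "p \<in> generated (generators n)"
  using assms finite_lessThan
proof (induction rule: permutes_induct)
  case id
  then show ?case by (rule generated.id)
next
  case (swap a b p)
  then have "Transposition.transpose a b \<in> generated (generators n)"
    using less_transpose_generated[of a b n] less_transpose_generated[of b a n]
    by (cases a b rule: linorder_cases) (auto simp: transpose_commute)
  then show ?case using swap.IH by (rule generated_comp)
qed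

text \<open>Every one-point update is conjugate, by a permutation, to one of the two generators that
  change only the value at \<open>0\<close>: merging if \<open>q < n\<close>, making undefined if
  \<open>q = n\<close>.\<close>

lemma update_generated:
  assumes p: "p < n" and q: "q \<le> n"
  shows "id(p := q) \<in> generated (generators n)"
proof (cases "p = q")
  case True
  then have "id(p := q) = id" by auto
  then show ?thesis by (simp add: generated.id)
next
  case False
  \<comment> \<open>First \<open>p\<close> is sent to \<open>0\<close>, then the image of
    \<open>q\<close> to \<open>n - 1\<close>. The second swap leaves \<open>0\<close> alone: the
    image of \<open>q\<close> is not \<open>0\<close> because \<open>p\<close> and \<open>q\<close>
    differ, and two distinct points below \<open>n\<close> force \<open>n - 1\<close> to be nonzero.
    If \<open>q = n\<close>, the first swap already fixes \<open>q\<close>.\<close>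
  define \<sigma> where "\<sigma> = (if q = n then Transposition.transpose 0 p
    else Transposition.transpose (n - 1) (Transposition.transpose 0 p q) \<circ> Transposition.transpose 0 p)"
  define q' where "q' = (if q = n then n else n - 1)"
  have t0: "Transposition.transpose 0 p permutes {..<n}"
    using p by (intro permutes_swap_id) auto
  have perm: "\<sigma> permutes {..<n}"
  proof (cases "q = n")
    case True
    then show ?thesis using t0 by (simp add: \<sigma>_def)
  next
    case False
    then have "Transposition.transpose 0 p q < n" using p q by (auto simp: Transposition.transpose_def)
    then have "Transposition.transpose (n - 1) (Transposition.transpose 0 p q) permutes {..<n}"
      using p by (intro permutes_swap_id) auto
    then show ?thesis using t0 False by (simp add: \<sigma>_def permutes_compose)
  qed
  have \<sigma>: "\<sigma> p = 0" "\<sigma> q = q'"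
    using False p q by (auto simp: \<sigma>_def q'_def Transposition.transpose_def)
  have "inv \<sigma> \<circ> id(0 := q') \<circ> \<sigma> \<in> generated (generators n)"
  proof (intro generated_comp)
    show "inv \<sigma> \<in> generated (generators n)" "\<sigma> \<in> generated (generators n)"
      by (rule permutes_generated[OF permutes_inv[OF perm]], rule permutes_generated[OF perm])
    show "id(0 := q') \<in> generated (generators n)"
      unfolding q'_def using generator_generated(4,5)[of n] by (cases "q = n") auto
  qed
  moreover have "inv \<sigma> \<circ> id(0 := q') \<circ> \<sigma> = id(p := q)"
  proof
    fix x
    have inj: "\<sigma> x = 0 \<longleftrightarrow> x = p"
      using \<sigma>(1) permutes_inj[OF perm] by (metis injD)
    show "(inv \<sigma> \<circ> id(0 := q') \<circ> \<sigma>) x = (id(p := q)) x"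
      using inj permutes_inverses(2)[OF perm] \<sigma>(2)[symmetric] by auto
  qed
  ultimately show ?thesis by simp
qed

text \<open>Induction on the defect \<open>n - card (f ` {..<n} \<inter> {..<n})\<close>: if \<open>f\<close> is not a permutation, some
  \<open>p\<close> is missed, and redirecting to \<open>p\<close> a point with a shared or undefined value raises the rank;
  \<open>f\<close> is recovered by one update at \<open>p\<close>.\<close>

lemma partial_maps_generated:
  "f \<in> partial_maps n \<Longrightarrow> f \<in> generated (generators n)"
proof (induction "n - card (f ` {..<n} \<inter> {..<n})" arbitrary: f rule: less_induct)
  case less
  let ?R = "\<lambda>f. f ` {..<n} \<inter> {..<n}"
  have f: "\<And>x. x < n \<Longrightarrow> f x \<le> n" "\<And>x. x \<ge> n \<Longrightarrow> f x = x"
    using less.prems by (auto simp: partial_maps_def)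
  show ?case
  proof (cases "?R f = {..<n}")
    case True
    then have "{..<n} \<subseteq> f ` {..<n}" by blast
    then have inj: "inj_on f {..<n}"
      by (metis card_image_le card_mono eq_card_imp_inj_on finite_imageI finite_lessThan le_antisym)
    then have "f ` {..<n} = {..<n}"
      using \<open>{..<n} \<subseteq> f ` {..<n}\<close> by (metis card_image card_subset_eq finite_imageI finite_lessThan)
    then have "f permutes {..<n}"
      using inj f(2) by (intro bij_imp_permutes) (auto simp: bij_betw_def)
    then show ?thesis by (rule permutes_generated)
  next
    case False
    then obtain p where p: "p < n" "p \<notin> f ` {..<n}" by blast
    obtain x where x: "x < n" "?R f \<subseteq> f ` ({..<n} - {x})"
    proof (cases "inj_on f {..<n}")
      case True
      \<comment> \<open>An injective self-map of a finite set would be onto and hit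
        \<open>p\<close>, so some point must be undefined.\<close>
      have "\<not> f ` {..<n} \<subseteq> {..<n}"
        using True p endo_inj_surj[of "{..<n}" f] by auto
      then obtain x where "x < n" "f x \<ge> n" by (meson image_subsetI lessThan_iff not_le)
      then show ?thesis by (intro that[of x]) auto
    next
      case False
      then obtain x y where "x < n" "y < n" "x \<noteq> y" "f x = f y" by (auto simp: inj_on_def)
      moreover from this have "f ` {..<n} \<subseteq> f ` ({..<n} - {x})" by (auto simp: image_iff)
      ultimately show ?thesis by (intro that[of x]) auto
    qed
    define g where "g = f(x := p)"
    have "insert p (?R f) \<subseteq> ?R g" using p x by (auto simp: g_def)
    then have "card (insert p (?R f)) \<le> card (?R g)" by (intro card_mono) auto
    moreover have "card (insert p (?R f)) = Suc (card (?R f))" using p by (subst card_insert_disjoint) auto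
    moreover have "card (?R g) \<le> card {..<n}" by (intro card_mono) auto
    ultimately have "n - card (?R g) < n - card (?R f)" by simp
    moreover have "g \<in> partial_maps n" using less.prems p x by (auto simp: partial_maps_def g_def)
    ultimately have "g \<in> generated (generators n)" by (rule less.hyps)
    then have "id(p := f x) \<circ> g \<in> generated (generators n)"
      using p x f by (intro generated_comp update_generated)
    moreover have "id(p := f x) \<circ> g = f"
    proof
      fix y
      \<comment> \<open>The final update at \<open>p\<close> can affect only \<open>x\<close>, since
        \<open>f\<close> never takes the value \<open>p\<close>; from \<open>n\<close> on it is the
        identity, with values above \<open>p\<close>.\<close>
      have "f y \<noteq> p" using p f(2)[of y] by (cases "y < n") auto
      then show "(id(p := f x) \<circ> g) y = f y" by (simp add: g_def)
    qed
    ultimately show ?thesis by simp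
  qed
qed

section \<open>The observer and the product when all events are observable\<close>

lemma eclose_all_observable: "eclose (events N) N q = {q}"
  by (simp add: eclose_def)

lemma projected_all_observable: "projected (events N) N = N"
  by (simp add: projected_def eclose_all_observable)

lemma reach_subset:
  assumes "init M \<subseteq> S" and "\<And>q a. q \<in> S \<Longrightarrow> a \<in> events M \<Longrightarrow> trans M q a \<subseteq> S"
  shows "reach M \<subseteq> S"
  unfolding reach_def using trans_star_sub[of S "events M" M "init M"] assms by blast

lemma cluster_union_simps [simp]:
  "states (cluster_union A C) = C \<times> states A"
  "events (cluster_union A C) = events A"
  "trans (cluster_union A C) (c, q) a = {c} \<times> trans A q a"
  "init (cluster_union A C) = (\<lambda>c. (c, fst c)) ` C"
  "final (cluster_union A C) = (SIGMA c:C. snd c)"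
  by (auto simp: cluster_union_def disjoint_union_def with_init_final_def split: prod.splits)

text \<open>The components do not interact, so a reached set splits into one independent run per
  cluster. Both bounds count such families.\<close>

lemma trans_star_cluster_union:
  "trans_star (cluster_union A C) (init (cluster_union A C)) w = (SIGMA c:C. trans_star A {fst c} w)"
  by (subst ts_pt) (auto simp: ts_cluster)

lemma subset_construction_simps [simp]:
  "events (subset_construction N) = events N"
  "trans (subset_construction N) X a = {image_trans N X a}"
  "init (subset_construction N) = {init N}"
  by (simp_all add: subset_construction_def)

lemma reach_subset_construction:
  "reach (subset_construction N) = trans_star N (init N) ` lists (events N)"
  by (auto simp: reach_def ts_subset_construction)

text \<open>This is the automaton explored in the second phase of \<open>ifo_algorithm\<close>, with
  the projection left out because it is the identity when all events are observable.\<close>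

definition opacity_product ::
    "('q, 'a) automaton \<Rightarrow> ('q \<times> 'q set) set \<Rightarrow> ('q \<times> 'q set) set
     \<Rightarrow> ((('q \<times> 'q set) \<times> 'q) \<times> (('q \<times> 'q set) \<times> 'q) set, 'a) nfa" where
  "opacity_product A C\<^sub>S C\<^sub>N =
     (let D = subset_construction (cluster_union A C\<^sub>N)
      in product (cluster_union A C\<^sub>S) (complement (restrict_states D (reach D))))"

lemma opacity_product_simps [simp]:
  "events (opacity_product A C\<^sub>S C\<^sub>N) = events A"
  "init (opacity_product A C\<^sub>S C\<^sub>N) = init (cluster_union A C\<^sub>S) \<times>
     ({init (cluster_union A C\<^sub>N)} \<inter> reach (subset_construction (cluster_union A C\<^sub>N)))"
  "a \<in> events A \<Longrightarrow> trans (opacity_product A C\<^sub>S C\<^sub>N) (p, X) a = trans (cluster_union A C\<^sub>S) p a \<times>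
     ({image_trans (cluster_union A C\<^sub>N) X a} \<inter> reach (subset_construction (cluster_union A C\<^sub>N)))"
  by (simp_all add: opacity_product_def Let_def product_def complement_def restrict_states_def)

lemma cluster_union_closed:
  assumes "automaton A" "q \<in> C \<times> states A" "a \<in> events A"
  shows "trans (cluster_union A C) q a \<subseteq> C \<times> states A"
  using assms by (cases q) (auto simp: automaton_def)

text \<open>An overapproximation suffices for counting: the first factor has at most quadratically
  many elements, the second is the observer.\<close>

lemma reach_opacity_product:
  assumes "automaton A" and "C\<^sub>S \<subseteq> states A \<times> Pow (states A)"
  shows "reach (opacity_product A C\<^sub>S C\<^sub>N)
    \<subseteq> (C\<^sub>S \<times> states A) \<times> reach (subset_construction (cluster_union A C\<^sub>N))"
proof (rule reach_subset)
  show "init (opacity_product A C\<^sub>S C\<^sub>N)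
      \<subseteq> (C\<^sub>S \<times> states A) \<times> reach (subset_construction (cluster_union A C\<^sub>N))"
    using assms(2) by auto
  fix q a
  assume "q \<in> (C\<^sub>S \<times> states A) \<times> reach (subset_construction (cluster_union A C\<^sub>N))"
    and a: "a \<in> events (opacity_product A C\<^sub>S C\<^sub>N)"
  then obtain p X where "q = (p, X)" "p \<in> C\<^sub>S \<times> states A" by auto
  then show "trans (opacity_product A C\<^sub>S C\<^sub>N) q a
      \<subseteq> (C\<^sub>S \<times> states A) \<times> reach (subset_construction (cluster_union A C\<^sub>N))"
    using cluster_union_closed[OF assms(1)] a by fastforce
qed

lemma finite_clusters:
  assumes "automaton A" "C \<subseteq> states A \<times> Pow (states A)"
  shows "finite C"
  using finite_subset[OF assms(2)] assms(1) by (simp add: automaton_def)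

lemma reach_observer:
  assumes "automaton A" and "C \<subseteq> states A \<times> Pow (states A)"
  shows "reach (subset_construction (cluster_union A C)) \<subseteq> Pow (C \<times> states A)"
proof (rule reach_subset)
  fix X a
  assume "X \<in> Pow (C \<times> states A)" "a \<in> events (subset_construction (cluster_union A C))"
  then show "trans (subset_construction (cluster_union A C)) X a \<subseteq> Pow (C \<times> states A)"
    using cluster_union_closed[OF assms(1)] by (fastforce simp: image_trans_def)
qed (use assms(2) in auto)

text \<open>Both searches stay in finite sets, so \<open>explore_eq\<close> gives their exact cost.
  The upper bound estimates every summand of this equation; the lower bound keeps only
  \<open>card V\<close>.\<close>

lemma ifo_time_all_observable:
  fixes A :: "('q, 'a) automaton"
  assumes A: "automaton A"
    and CS: "C\<^sub>S \<subseteq> states A \<times> Pow (states A)" and CN: "C\<^sub>N \<subseteq> states A \<times> Pow (states A)"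
  defines "A\<^sub>S \<equiv> cluster_union A C\<^sub>S" and "A\<^sub>N \<equiv> cluster_union A C\<^sub>N"
  defines "V \<equiv> reach (subset_construction A\<^sub>N)" and "B \<equiv> opacity_product A C\<^sub>S C\<^sub>N"
  shows "ifo_time A C\<^sub>S C\<^sub>N (events A) = enat
    (nfa_size A\<^sub>S + nfa_size A\<^sub>N + projection_time (events A) A\<^sub>N
     + (1 + card (init A\<^sub>N)) + (\<Sum>X\<in>V. subset_time A\<^sub>N X) + card V
     + (1 + card (init B)) + (\<Sum>q\<in>reach B. state_time B q))"
proof -
  have finQ: "finite (states A)" using A by (simp add: automaton_def)
  note fin = finite_clusters[OF A CS] finite_clusters[OF A CN] finQ
  have V: "V \<subseteq> Pow (C\<^sub>N \<times> states A)" unfolding V_def A\<^sub>N_def by (rule reach_observer[OF A CN])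
  have P: "projected (events A) A\<^sub>N = A\<^sub>N"
    using projected_all_observable[of A\<^sub>N] by (simp add: A\<^sub>N_def)
  have eD: "explore (subset_construction A\<^sub>N) (subset_time A\<^sub>N) = Some (V, \<Sum>X\<in>V. subset_time A\<^sub>N X)"
    unfolding V_def
  proof (rule explore_eq[of "Pow (C\<^sub>N \<times> states A)"])
    fix X a
    assume "X \<in> Pow (C\<^sub>N \<times> states A)" "a \<in> events (subset_construction A\<^sub>N)"
    then show "trans (subset_construction A\<^sub>N) X a \<subseteq> Pow (C\<^sub>N \<times> states A)"
      using cluster_union_closed[OF A] by (fastforce simp: image_trans_def A\<^sub>N_def)
  qed (use fin CN in \<open>auto simp: A\<^sub>N_def\<close>)
  have eB: "explore B (state_time B) = Some (reach B, \<Sum>q\<in>reach B. state_time B q)"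
  proof (rule explore_eq[of "(C\<^sub>S \<times> states A) \<times> V"])
    show "finite ((C\<^sub>S \<times> states A) \<times> V)" using fin V by (auto intro: finite_subset)
    show "init B \<subseteq> (C\<^sub>S \<times> states A) \<times> V" using CS by (auto simp: B_def V_def A\<^sub>N_def)
    fix q a
    assume "q \<in> (C\<^sub>S \<times> states A) \<times> V" and a: "a \<in> events B"
    then obtain p X where "q = (p, X)" "p \<in> C\<^sub>S \<times> states A" by auto
    then show "trans B q a \<subseteq> (C\<^sub>S \<times> states A) \<times> V"
      using cluster_union_closed[OF A] a by (fastforce simp: B_def V_def A\<^sub>N_def)
  qed
  have B: "product A\<^sub>S (complement (restrict_states (subset_construction A\<^sub>N) V)) = B"
    by (simp add: B_def opacity_product_def Let_def A\<^sub>S_def A\<^sub>N_def V_def)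
  show ?thesis
    by (simp add: ifo_time_def ifo_algorithm_def A\<^sub>S_def[symmetric] A\<^sub>N_def[symmetric] P eD B eB Let_def)
qed

section \<open>Number and size of the observer states\<close>

lemma clustered_form_subset: "clustered_form Q S C \<Longrightarrow> C \<subseteq> Q \<times> Pow Q"
  by (simp add: clustered_form_def)

text \<open>The second component of a cluster is determined by the first through \<open>S\<close>,
  so \<open>fst\<close> is injective on \<open>C\<close>.\<close>

lemma card_clustered_form:
  assumes "clustered_form Q S C" "finite Q"
  shows "card C \<le> card Q"
proof (rule card_inj_on_le)
  show "fst ` C \<subseteq> Q" using clustered_form_subset[OF assms(1)] by auto
  have "f \<in> T \<longleftrightarrow> (s, f) \<in> S" if "(s, T) \<in> C" for s T f
    using assms(1) that by (fastforce simp: clustered_form_def)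
  then have "T = T'" if "(s, T) \<in> C" "(s, T') \<in> C" for s T T'
    using that by blast
  then show "inj_on fst C" unfolding inj_on_def by (metis prod.collapse)
qed (fact assms(2))

lemma card_le_1_cases [consumes 2, case_names empty singleton]:
  assumes "finite X" "card X \<le> 1"
  obtains "X = {}" | q where "X = {q}"
  using assms by (cases "card X") (auto simp: card_1_singleton_iff)

lemma card_trans_star_le:
  assumes "automaton A" "deterministic A" "s \<in> states A" "w \<in> lists (events A)"
  shows "trans_star A {s} w \<subseteq> states A \<and> card (trans_star A {s} w) \<le> 1"
  using assms(4)
proof (induction w rule: rev_induct)
  case Nil
  then show ?case using assms(3) by simp
next
  case (snoc a w)
  then have IH: "trans_star A {s} w \<subseteq> states A" "card (trans_star A {s} w) \<le> 1" and a: "a \<in> events A"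
    by simp_all
  have "finite (trans_star A {s} w)" using IH(1) assms(1) by (auto simp: automaton_def intro: finite_subset)
  then show ?case
    using IH(2)
  proof (cases rule: card_le_1_cases)
    case (singleton q)
    then have "q \<in> states A" using IH by simp
    then show ?thesis using singleton assms(1,2) a
      by (simp add: ts_snoc image_trans_def automaton_def deterministic_def)
  qed (simp add: ts_snoc image_trans_def)
qed

text \<open>By determinism each cluster has at most \<open>n + 1\<close> possible contributions, a
  single state or nothing. The second claim adds up contributions of size at most one and later
  keeps the time per observer state linear in \<open>n\<close>.\<close>

lemma observer_bounds:
  assumes A: "automaton A" "deterministic A" and C: "clustered_form (states A) S C"
  defines "V \<equiv> reach (subset_construction (cluster_union A C))" and "n \<equiv> card (states A)"
  shows "card V \<le> (n + 1) ^ n" and "X \<in> V \<Longrightarrow> card X \<le> n"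
proof -
  note CQ = clustered_form_subset[OF C]
  have finQ: "finite (states A)" using A by (simp add: automaton_def)
  have finC: "finite C" by (rule finite_clusters[OF A(1) CQ])
  have Cn: "card C \<le> n" unfolding n_def by (rule card_clustered_form[OF C finQ])
  have el: "\<exists>w\<in>lists (events A). X = (SIGMA c:C. trans_star A {fst c} w)" if "X \<in> V" for X
    using that by (auto simp: V_def reach_subset_construction trans_star_cluster_union
        simp del: cluster_union_simps(4))
  have ts: "trans_star A {fst c} w \<subseteq> states A \<and> card (trans_star A {fst c} w) \<le> 1"
    if "c \<in> C" "w \<in> lists (events A)" for c w
  proof -
    have "fst c \<in> states A" using CQ that(1) by auto
    then show ?thesis by (rule card_trans_star_le[OF A _ that(2)])
  qed
  \<comment> \<open>An observer state is coded by a function on clusters, where \<open>None\<close>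
    stands for a run that has died. Extensional functions make the count an exact power.\<close>
  let ?G = "C \<rightarrow>\<^sub>E insert None (Some ` states A)"
  let ?F = "\<lambda>h. {(c, q). c \<in> C \<and> h c = Some q}"
  have "V \<subseteq> ?F ` ?G"
  proof
    fix X assume "X \<in> V"
    then obtain w where w: "w \<in> lists (events A)" "X = (SIGMA c:C. trans_star A {fst c} w)"
      using el by blast
    define h where "h = (\<lambda>c\<in>C. if trans_star A {fst c} w = {} then None
      else Some (the_elem (trans_star A {fst c} w)))"
    have h: "trans_star A {fst c} w = {q. h c = Some q}" "h c \<in> insert None (Some ` states A)"
      if c: "c \<in> C" for c
    proof -
      have sub: "trans_star A {fst c} w \<subseteq> states A" and le: "card (trans_star A {fst c} w) \<le> 1"
        using ts[OF c w(1)] by auto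
      from finite_subset[OF sub finQ] le
      have "trans_star A {fst c} w = {q. h c = Some q} \<and> h c \<in> insert None (Some ` states A)"
        using sub by (cases rule: card_le_1_cases) (auto simp: h_def c)
      then show "trans_star A {fst c} w = {q. h c = Some q}" "h c \<in> insert None (Some ` states A)"
        by auto
    qed
    have "h \<in> ?G" using h(2) by (auto simp: PiE_def h_def)
    moreover have "X = ?F h" unfolding w(2) using h(1) by auto
    ultimately show "X \<in> ?F ` ?G" by blast
  qed
  moreover have finG: "finite ?G" using finC finQ by (intro finite_PiE) auto
  ultimately have "card V \<le> card ?G" by (rule surj_card_le[rotated])
  also have "card ?G = (n + 1) ^ card C"
    using finC finQ by (simp add: card_PiE n_def card_image)
  also have "\<dots> \<le> (n + 1) ^ n" using Cn by (intro power_increasing) auto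
  finally show "card V \<le> (n + 1) ^ n" .
  assume "X \<in> V"
  then obtain w where w: "w \<in> lists (events A)" "X = (SIGMA c:C. trans_star A {fst c} w)"
    using el by blast
  have "card X = (\<Sum>c\<in>C. card (trans_star A {fst c} w))"
    unfolding w(2) using finC ts[OF _ w(1)] finQ by (intro card_SigmaI) (auto intro: finite_subset)
  also have "\<dots> \<le> (\<Sum>c\<in>C. 1)" using ts w(1) by (intro sum_mono) auto
  finally show "card X \<le> n" using Cn by simp
qed

section \<open>Upper bound\<close>

lemma card_trans_cluster_union_le:
  assumes "deterministic A" "q \<in> C \<times> states A" "a \<in> events A"
  shows "card (trans (cluster_union A C) q a) \<le> 1"
  using assms by (cases q) (simp add: card_cartesian_product deterministic_def)

lemma card_init_cluster_union_le:
  assumes "clustered_form (states A) S C" "automaton A"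
  shows "card (init (cluster_union A C)) \<le> card (states A)"
proof -
  have "finite (states A)" using assms(2) by (simp add: automaton_def)
  then show ?thesis
    using card_clustered_form[OF assms(1)] card_image_le[of C "\<lambda>c. (c, fst c)"]
      finite_clusters[OF assms(2) clustered_form_subset[OF assms(1)]] by simp
qed

lemma card_cluster_union_states_le:
  assumes "clustered_form (states A) S C" "automaton A"
  shows "card (C \<times> states A) \<le> (card (states A))\<^sup>2"
  using card_clustered_form[OF assms(1)] assms(2)
  by (simp add: card_cartesian_product power2_eq_square automaton_def)

lemma sum_le_mult:
  fixes f :: "'a \<Rightarrow> nat"
  assumes "\<And>x. x \<in> X \<Longrightarrow> f x \<le> c" "card X \<le> m"
  shows "sum f X \<le> m * c"
proof -
  have "sum f X \<le> card X * c" using sum_bounded_above[of X f c] assms(1) by simp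
  also have "\<dots> \<le> m * c" using assms(2) by simp
  finally show ?thesis .
qed

text \<open>The summands bound, in order, states, events, transition lists, initial and final
  states; determinism gives each transition list cost at most \<open>2\<close>.\<close>

lemma nfa_size_cluster_union_le:
  assumes "automaton A" "deterministic A" "clustered_form (states A) S C"
  defines "n \<equiv> card (states A)" and "k \<equiv> card (events A)"
  shows "nfa_size (cluster_union A C) \<le> n\<^sup>2 + k + n\<^sup>2 * (k * 2) + n + n\<^sup>2"
proof -
  note CQ = clustered_form_subset[OF assms(3)]
  have fin: "finite (C \<times> states A)"
    using finite_clusters[OF assms(1) CQ] assms(1) by (simp add: automaton_def)
  note st = card_cluster_union_states_le[OF assms(3,1), folded n_def]
  have "card (SIGMA c:C. snd c) \<le> card (C \<times> states A)"
    by (rule card_mono[OF fin]) (use CQ in fastforce)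
  moreover have "(\<Sum>q\<in>C \<times> states A. \<Sum>a\<in>events A. 1 + card (trans (cluster_union A C) q a)) \<le> n\<^sup>2 * (k * 2)"
    using card_trans_cluster_union_le[OF assms(2)] st
    by (intro sum_le_mult) (auto simp: k_def)
  moreover have "card (init (cluster_union A C)) \<le> n"
    unfolding n_def by (rule card_init_cluster_union_le[OF assms(3,1)])
  ultimately show ?thesis
    using st by (simp add: nfa_size_def k_def del: cluster_union_simps(3,4))
qed

text \<open>All closures are singletons, so the search costs \<open>1\<close> per state, the
  tabulation at most \<open>4\<close> per state and event, and each initial state
  \<open>2\<close>.\<close>

lemma projection_time_cluster_union_le:
  assumes "automaton A" "deterministic A" "clustered_form (states A) S C"
  defines "n \<equiv> card (states A)" and "k \<equiv> card (events A)"
  shows "projection_time (events A) (cluster_union A C) \<le> n\<^sup>2 * 1 + n\<^sup>2 * (k * 4) + n * 2"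
proof -
  note st = card_cluster_union_states_le[OF assms(3,1), folded n_def]
  have ecl: "eclose (events A) (cluster_union A C) q = {q}" for q
    using eclose_all_observable[of "cluster_union A C" q] by simp
  have trans: "card (trans (cluster_union A C) q a) \<le> 1" if "q \<in> C \<times> states A" "a \<in> events A" for q a
    using card_trans_cluster_union_le[OF assms(2) that] .
  have "(\<Sum>q\<in>C \<times> states A. 1) \<le> n\<^sup>2 * 1"
    using st by (intro sum_le_mult) auto
  moreover have "1 + (1 + (\<Sum>r\<in>trans (cluster_union A C) q a. 1 + 1)) \<le> (4 :: nat)"
    if "q \<in> C \<times> states A" "a \<in> events A" for q a
    using trans[OF that] by (simp del: cluster_union_simps(3))
  then have "(\<Sum>q\<in>C \<times> states A. \<Sum>a\<in>events A. 1 + (1 + (\<Sum>r\<in>trans (cluster_union A C) q a. 1 + 1)))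
      \<le> n\<^sup>2 * (k * 4)"
    using st by (intro sum_le_mult) (simp_all add: k_def del: cluster_union_simps(3))
  moreover have "(\<Sum>q\<in>init (cluster_union A C). 1 + 1) \<le> n * 2"
    using card_init_cluster_union_le[OF assms(3,1)] by (intro sum_le_mult) (auto simp: n_def)
  ultimately show ?thesis
    by (simp add: projection_time_def ecl del: cluster_union_simps(3,4))
qed

text \<open>The computed successor set is again a reachable observer state, so the bound
  \<open>n\<close> on cardinalities applies to it as well as to \<open>X\<close>.\<close>

lemma subset_time_observer_le:
  assumes "automaton A" "deterministic A" "clustered_form (states A) S C"
    and X: "X \<in> reach (subset_construction (cluster_union A C))"
  defines "n \<equiv> card (states A)" and "k \<equiv> card (events A)"
  shows "subset_time (cluster_union A C) X \<le> 1 + n + k * (1 + n * 2 + (1 + n))"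
proof -
  let ?N = "cluster_union A C"
  note bound = observer_bounds(2)[OF assms(1-3), folded n_def]
  have sub: "X \<subseteq> C \<times> states A"
    using reach_observer[OF assms(1) clustered_form_subset[OF assms(3)]] X by blast
  have im: "card (image_trans ?N X a) \<le> n" if a: "a \<in> events A" for a
  proof (rule bound)
    obtain w where "w \<in> lists (events ?N)" "X = trans_star ?N (init ?N) w"
      using X unfolding reach_subset_construction by blast
    then have "image_trans ?N X a = trans_star ?N (init ?N) (w @ [a])" "w @ [a] \<in> lists (events ?N)"
      using a by (simp_all add: ts_snoc)
    then show "image_trans ?N X a \<in> reach (subset_construction ?N)"
      unfolding reach_subset_construction by blast
  qed
  have tr: "(\<Sum>q\<in>X. 1 + card (trans ?N q a)) \<le> n * 2" if "a \<in> events A" for a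
    using card_trans_cluster_union_le[OF assms(2) _ that] sub bound[OF X]
    by (intro sum_le_mult) fastforce+
  have "(\<Sum>a\<in>events A. 1 + (\<Sum>q\<in>X. 1 + card (trans ?N q a)) + (1 + card (image_trans ?N X a)))
      \<le> k * (1 + n * 2 + (1 + n))"
    by (intro sum_le_mult add_mono im tr) (simp_all add: k_def)
  then show ?thesis using bound[OF X] by (simp add: subset_time_def del: cluster_union_simps(3,4))
qed

text \<open>Both factors have at most one successor per event, so for a fixed alphabet the cost is
  constant.\<close>

lemma state_time_opacity_product_le:
  assumes "deterministic A" "q \<in> (C\<^sub>S \<times> states A) \<times> V"
  shows "state_time (opacity_product A C\<^sub>S C\<^sub>N) q \<le> 1 + card (events A) * 2"
proof -
  obtain p X where q: "q = (p, X)" "p \<in> C\<^sub>S \<times> states A" using assms(2) by auto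
  have "card (trans (opacity_product A C\<^sub>S C\<^sub>N) q a) \<le> 1" if a: "a \<in> events A" for a
  proof -
    have "card ({Y} \<inter> Z) \<le> 1" for Y :: "(('a \<times> 'a set) \<times> 'a) set" and Z
      using card_mono[of "{Y}" "{Y} \<inter> Z"] by simp
    from mult_le_mono[OF card_trans_cluster_union_le[OF assms(1) q(2) a] this]
    show ?thesis
      using a by (simp add: q(1) card_cartesian_product del: cluster_union_simps(3) One_nat_def)
  qed
  then have "(\<Sum>a\<in>events A. 1 + card (trans (opacity_product A C\<^sub>S C\<^sub>N) q a)) \<le> card (events A) * 2"
    by (intro sum_le_mult) auto
  then show ?thesis by (simp add: state_time_def del: opacity_product_simps(3))
qed

text \<open>The dominant term is the exploration of the product. The summand in
  \<open>n\<^sup>2 + 1\<close> keeps the bound valid at \<open>n = 0\<close>, where the running time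
  is still positive; \<open>34\<close> is a generous constant.\<close>

lemma ifo_time_le:
  assumes A: "automaton A" "deterministic A"
    and CS: "clustered_form (states A) Q\<^sub>S C\<^sub>S" and CN: "clustered_form (states A) Q\<^sub>N C\<^sub>N"
  defines "n \<equiv> card (states A)" and "k \<equiv> card (events A)"
  shows "ifo_time A C\<^sub>S C\<^sub>N (events A) \<le> enat (34 * ((k + 1) * (n\<^sup>2 + 1) * (n + 1) ^ n))"
proof -
  let ?N = "cluster_union A C\<^sub>N"
  define V where "V = reach (subset_construction ?N)"
  let ?B = "opacity_product A C\<^sub>S C\<^sub>N"
  define M where "M = (n + 1) ^ n"
  note CSQ = clustered_form_subset[OF CS] and CNQ = clustered_form_subset[OF CN]
  have finQ: "finite (states A)" using A(1) by (simp add: automaton_def)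
  have V: "card V \<le> M"
    using observer_bounds(1)[OF A CN] by (simp add: V_def n_def M_def)
  have finV: "finite V"
    using reach_observer[OF A(1) CNQ] finite_clusters[OF A(1) CNQ] finQ
    unfolding V_def by (meson finite_Pow_iff finite_SigmaI finite_subset)
  have finCS: "finite (C\<^sub>S \<times> states A)"
    using finite_clusters[OF A(1) CSQ] finQ by simp
  have t1: "(\<Sum>X\<in>V. subset_time ?N X) \<le> M * (1 + n + k * (1 + n * 2 + (1 + n)))"
    using subset_time_observer_le[OF A CN] V
    unfolding V_def n_def k_def by (intro sum_le_mult) auto
  have iB: "card (init ?B) \<le> n"
  proof -
    have "card (init ?B) \<le> card (init (cluster_union A C\<^sub>S)) * card {init ?N}"
      unfolding opacity_product_simps(2) card_cartesian_product
      using finite_clusters[OF A(1) CSQ] by (intro mult_le_mono card_mono) auto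
    then show ?thesis using card_init_cluster_union_le[OF CS A(1)] by (simp add: n_def)
  qed
  have t2: "(\<Sum>q\<in>reach ?B. state_time ?B q) \<le> (n\<^sup>2 * M) * (1 + k * 2)"
  proof (rule sum_le_mult)
    have sub: "reach ?B \<subseteq> (C\<^sub>S \<times> states A) \<times> V"
      unfolding V_def by (rule reach_opacity_product[OF A(1) CSQ])
    then have "card (reach ?B) \<le> card ((C\<^sub>S \<times> states A) \<times> V)"
      using finCS finV by (intro card_mono) auto
    also have "\<dots> \<le> n\<^sup>2 * M"
      unfolding card_cartesian_product[of "C\<^sub>S \<times> states A"]
      using card_cluster_union_states_le[OF CS A(1)] V unfolding n_def by (rule mult_le_mono)
    finally show "card (reach ?B) \<le> n\<^sup>2 * M" .
    show "state_time ?B q \<le> 1 + k * 2" if "q \<in> reach ?B" for q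
      unfolding k_def using state_time_opacity_product_le[OF A(2)] that sub by blast
  qed
  let ?s = "n\<^sup>2 + k + n\<^sup>2 * (k * 2) + n + n\<^sup>2"
  let ?p = "n\<^sup>2 * 1 + n\<^sup>2 * (k * 4) + n * 2"
  let ?x = "1 + n + k * (1 + n * 2 + (1 + n))"
  \<comment> \<open>\<open>?a\<close> collects the polynomial phases, and \<open>?b\<close> is the
    coefficient of \<open>M\<close>: processing and numbering an observer state, plus its share of
    the product. Since \<open>M\<close> is at least \<open>1\<close>, it absorbs \<open>?a\<close>
    too.\<close>
  let ?a = "?s + ?s + ?p + (1 + n) + (1 + n)"
  let ?b = "?x + 1 + n\<^sup>2 * (1 + k * 2)"
  have time: "ifo_time A C\<^sub>S C\<^sub>N (events A)
      \<le> enat (?s + ?s + ?p + (1 + n) + M * ?x + M + (1 + n) + n\<^sup>2 * M * (1 + k * 2))"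
    unfolding ifo_time_all_observable[OF A(1) CSQ CNQ] enat_ord_simps V_def[symmetric]
    using nfa_size_cluster_union_le[OF A CS] nfa_size_cluster_union_le[OF A CN]
      projection_time_cluster_union_le[OF A CN] card_init_cluster_union_le[OF CN A(1)]
    unfolding n_def[symmetric] k_def[symmetric]
    by (intro add_mono order_refl t1 V iB t2)
  have "?s + ?s + ?p + (1 + n) + M * ?x + M + (1 + n) + n\<^sup>2 * M * (1 + k * 2) = ?a + M * ?b"
    by (simp add: algebra_simps)
  also have "?a + M * ?b \<le> M * ?a + M * ?b"
  proof (rule add_right_mono)
    have "1 \<le> M" by (simp add: M_def)
    then show "?a \<le> M * ?a" by (metis mult_1 mult_le_mono1)
  qed
  also have "\<dots> = M * (?a + ?b)" by (simp only: distrib_left)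
  also have "\<dots> \<le> M * (34 * ((k + 1) * (n\<^sup>2 + 1)))"
  proof (rule mult_le_mono2)
    \<comment> \<open>After cancelling common monomials only the terms linear in \<open>n\<close>
      remain on the left; they are dominated by the quadratic ones.\<close>
    have n: "n \<le> n\<^sup>2" by (simp add: power2_nat_le_imp_le power2_eq_square)
    then have "k * (n * 3) \<le> k * (n\<^sup>2 * 24)" by (intro mult_le_mono2) linarith
    with n have "n * 7 + k * (n * 3) \<le> 30 + (k * 30 + (n\<^sup>2 * 28 + k * (n\<^sup>2 * 24)))" by linarith
    then show "?a + ?b \<le> 34 * ((k + 1) * (n\<^sup>2 + 1))" by (simp add: algebra_simps)
  qed
  also have "M * (34 * ((k + 1) * (n\<^sup>2 + 1))) = 34 * ((k + 1) * (n\<^sup>2 + 1) * (n + 1) ^ n)"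
    by (simp only: M_def mult_ac)
  finally show ?thesis using order_trans[OF time] by (simp only: enat_ord_simps)
qed

text \<open>The alphabet size is fixed and goes into the constant. The factor \<open>34\<close>
  doubles because \<open>n\<^sup>2 + 1\<close> is at most twice \<open>n\<^sup>2\<close> once
  \<open>n\<close> is positive.\<close>

lemma time_bound_bigo:
  "(\<lambda>n. real (34 * ((k + 1) * (n\<^sup>2 + 1) * (n + 1) ^ n))) \<in> O(\<lambda>n. (real n)\<^sup>2 * (real n + 1) ^ n)"
proof (rule bigoI[where c = "68 * (real k + 1)"])
  have "real (34 * ((k + 1) * (n\<^sup>2 + 1) * (n + 1) ^ n)) \<le> 68 * (real k + 1) * ((real n)\<^sup>2 * (real n + 1) ^ n)"
    if "n \<ge> 1" for n
  proof -
    have "(real n)\<^sup>2 + 1 \<le> 2 * (real n)\<^sup>2" using that by simp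
    have "real (34 * ((k + 1) * (n\<^sup>2 + 1) * (n + 1) ^ n))
        = 34 * (real k + 1) * ((real n)\<^sup>2 + 1) * (real n + 1) ^ n"
      by (simp only: of_nat_mult of_nat_add of_nat_power of_nat_1 of_nat_numeral mult.assoc)
    also have "\<dots> \<le> 34 * (real k + 1) * (2 * (real n)\<^sup>2) * (real n + 1) ^ n"
      using \<open>(real n)\<^sup>2 + 1 \<le> 2 * (real n)\<^sup>2\<close> by (intro mult_right_mono mult_left_mono) auto
    also have "\<dots> = 68 * (real k + 1) * ((real n)\<^sup>2 * (real n + 1) ^ n)"
      by (simp add: algebra_simps)
    finally show ?thesis .
  qed
  then show "\<forall>\<^sub>F n in sequentially.
      norm (real (34 * ((k + 1) * (n\<^sup>2 + 1) * (n + 1) ^ n)))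
      \<le> 68 * (real k + 1) * norm ((real n)\<^sup>2 * (real n + 1) ^ n)"
    by (intro eventually_sequentiallyI[of 1]) (simp add: abs_mult)
qed

section \<open>Lower bound\<close>

text \<open>Removing \<open>n\<close> turns the value for undefined into a missing transition.
  Events from \<open>5\<close> on act as the identity, so the alphabet can be enlarged
  freely.\<close>

definition partial_map_automaton :: "nat \<Rightarrow> nat \<Rightarrow> (nat, nat) automaton" where
  "partial_map_automaton k n =
     \<lparr>states = {..<n}, events = {..<k}, trans = (\<lambda>q a. {generator n a q} - {n})\<rparr>"

lemma partial_map_automaton_simps [simp]:
  "states (partial_map_automaton k n) = {..<n}"
  "events (partial_map_automaton k n) = {..<k}"
  "trans (partial_map_automaton k n) q a = {generator n a q} - {n}"
  by (simp_all add: partial_map_automaton_def)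

lemma partial_map_automaton:
  assumes "k \<ge> 1"
  shows "automaton (partial_map_automaton k n)" "deterministic (partial_map_automaton k n)"
proof -
  have "generator n a q \<le> n" if "q < n" for a q
    using generator_partial_maps[of n a] that by (auto simp: partial_maps_def)
  then show "automaton (partial_map_automaton k n)"
    using assms by (auto simp: automaton_def le_less)
  show "deterministic (partial_map_automaton k n)"
    using card_mono[of "{x}" "{x} - {n}" for x] by (auto simp: deterministic_def)
qed

text \<open>The start set \<open>{q} - {n}\<close> lets the induction pass through undefined values:
  every generator fixes \<open>n\<close>, matching the empty set staying empty.\<close>

lemma trans_star_partial_map_automaton:
  "trans_star (partial_map_automaton k n) ({q} - {n}) w
     = {foldl (\<lambda>x a. generator n a x) q w} - {n}"
proof (induction w arbitrary: q)
  case (Cons a w)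
  have "generator n a n = n" using generator_partial_maps[of n a] by (simp add: partial_maps_def)
  then have "image_trans (partial_map_automaton k n) ({q} - {n}) a = {generator n a q} - {n}"
    by (auto simp: image_trans_def)
  then show ?case using Cons by (simp add: ts_Cons)
qed simp

lemma generated_word:
  assumes "f \<in> generated (g ` K)"
  shows "\<exists>w\<in>lists K. \<forall>x. foldl (\<lambda>x a. g a x) x w = f x"
  using assms
proof induction
  case id
  then show ?case by (intro bexI[of _ "[]"]) auto
next
  case (step f h)
  then obtain w a where "w \<in> lists K" "\<forall>x. foldl (\<lambda>x a. g a x) x w = f x" "a \<in> K" "h = g a" by auto
  then show ?case by (intro bexI[of _ "w @ [a]"]) auto
qed

text \<open>The graphs \<open>\<Phi> h\<close> of the partial maps, coded as functions into
  \<open>{..n}\<close>, are pairwise distinct and all reachable.\<close>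

lemma card_reach_partial_map_observer:
  assumes "k \<ge> 5"
  shows "(n + 1) ^ n
    \<le> card (reach (subset_construction (cluster_union (partial_map_automaton k n) ((\<lambda>s. (s, {})) ` {..<n}))))"
proof -
  let ?A = "partial_map_automaton k n"
  let ?C = "(\<lambda>s. (s, {} :: nat set)) ` {..<n}"
  let ?V = "reach (subset_construction (cluster_union ?A ?C))"
  define \<Phi> where "\<Phi> h = (SIGMA c:?C. {h (fst c)} - {n})" for h :: "nat \<Rightarrow> nat"
  have aut: "automaton ?A" using partial_map_automaton(1) assms by simp
  have "?V \<subseteq> Pow (?C \<times> states ?A)" by (rule reach_observer[OF aut]) auto
  then have fin: "finite ?V" by (rule finite_subset) simp
  have "inj_on \<Phi> ({..<n} \<rightarrow>\<^sub>E {..n})"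
  proof (rule inj_onI)
    fix h h' assume h: "h \<in> {..<n} \<rightarrow>\<^sub>E {..n}" "h' \<in> {..<n} \<rightarrow>\<^sub>E {..n}" and eq: "\<Phi> h = \<Phi> h'"
    have "h s = h' s" if "s < n" for s
    proof -
      \<comment> \<open>The slice at one cluster recovers the value there, an empty slice meaning
        \<open>n\<close>.\<close>
      have "\<Phi> g `` {(s, {})} = {g s} - {n}" for g using that by (auto simp: \<Phi>_def)
      then have "{h s} - {n} = {h' s} - {n}" using eq by metis
      then show ?thesis by (cases "h s = n"; cases "h' s = n") auto
    qed
    then show "h = h'" using h by (intro PiE_ext) auto
  qed
  moreover have "\<Phi> h \<in> ?V" if h: "h \<in> {..<n} \<rightarrow>\<^sub>E {..n}" for h
  proof -
    \<comment> \<open>Extensional functions are unspecified beyond \<open>n\<close>; the identity is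
      put there to obtain an element of \<open>partial_maps n\<close>.\<close>
    define f where "f x = (if x < n then h x else x)" for x
    have "f \<in> partial_maps n" using h by (auto simp: f_def partial_maps_def)
    then obtain w where w: "w \<in> lists {..<5}" "\<And>x. foldl (\<lambda>x a. generator n a x) x w = f x"
      using generated_word[OF partial_maps_generated] by blast
    have "trans_star ?A {s} w = {h s} - {n}" if "s < n" for s
    proof -
      have "{s} - {n} = {s}" using that by auto
      then show ?thesis
        using trans_star_partial_map_automaton[of k n s w] that by (simp add: w(2) f_def)
    qed
    then have "trans_star (cluster_union ?A ?C) (init (cluster_union ?A ?C)) w = \<Phi> h"
      unfolding trans_star_cluster_union \<Phi>_def by (intro Sigma_cong) auto
    moreover have "w \<in> lists {..<k}" using w(1) assms by (auto simp: in_lists_conv_set)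
    ultimately show ?thesis unfolding reach_subset_construction by force
  qed
  ultimately have "card ({..<n} \<rightarrow>\<^sub>E {..n}) \<le> card ?V"
    using fin by (intro card_inj_on_le[of \<Phi>]) auto
  then show ?thesis by (simp add: card_PiE)
qed

theorem theorem7:
  shows "(\<forall>k. \<exists>f :: nat \<Rightarrow> nat.
            (\<lambda>n. real (f n)) \<in> O(\<lambda>n. (real n)\<^sup>2 * (real n + 1) ^ n) \<and>
            (\<forall>n. worst_case_time_det_obs k n \<le> enat (f n))) \<and>
         (\<exists>k\<^sub>0. \<forall>k\<ge>k\<^sub>0. \<forall>n. enat ((n + 1) ^ n) \<le> worst_case_time_det_obs k n)"
proof (intro conjI allI exI impI)
  \<comment> \<open>The witness for \<open>f\<close>, which depends on \<open>k\<close>, is fixed by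
    this statement.\<close>
  show "(\<lambda>n. real (34 * ((k + 1) * (n\<^sup>2 + 1) * (n + 1) ^ n))) \<in> O(\<lambda>n. (real n)\<^sup>2 * (real n + 1) ^ n)" for k
    by (rule time_bound_bigo)
  show "worst_case_time_det_obs k n \<le> enat (34 * ((k + 1) * (n\<^sup>2 + 1) * (n + 1) ^ n))" for k n
    unfolding worst_case_time_det_obs_def using ifo_time_le by (intro Sup_least) blast
next
  fix k n :: nat
  \<comment> \<open>This fixes the threshold at \<open>5\<close>, one event for each
    generator.\<close>
  assume k: "k \<ge> 5"
  let ?A = "partial_map_automaton k n"
  let ?C = "(\<lambda>s. (s, {} :: nat set)) ` {..<n}"
  have A: "automaton ?A" "deterministic ?A" using partial_map_automaton k by simp_all
  \<comment> \<open>The observer is built from the nonsecret clusters alone, so there need be no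
    secret ones. The clusters in \<open>?C\<close> represent the empty set of nonsecret
    pairs.\<close>
  have "enat ((n + 1) ^ n) \<le> ifo_time ?A {} ?C (events ?A)"
  proof (subst ifo_time_all_observable[OF A(1)])
    \<comment> \<open>The variables \<open>a\<close>, \<open>b\<close> and \<open>c\<close> stand
      for all other costs.\<close>
    show "enat ((n + 1) ^ n) \<le> enat (a + card (reach (subset_construction (cluster_union ?A ?C))) + b + c)" for a b c
      using card_reach_partial_map_observer[OF k, of n] by simp
  qed auto
  also have "\<dots> \<le> worst_case_time_det_obs k n"
    unfolding worst_case_time_det_obs_def
  proof (rule Sup_upper, rule CollectI, intro exI conjI)
    show "clustered_form (states ?A) {} {}" "clustered_form (states ?A) {} ?C"
      by (auto simp: clustered_form_def)
  qed (use A in auto)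
  finally show "enat ((n + 1) ^ n) \<le> worst_case_time_det_obs k n" .
qed

end
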